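(* Let $F,H_1,\dots,H_m,G_1,\dots,G_n,F_{i,j}\ (1\le i\le m,1\le j\le n)$ be real symmetric $p\times p$ matrices and define the bilinear matrix-valued function $\mathcal{B}(\mathbf{x},\mathbf{y})=F+\sum_{i=1}^m x_iH_i+\sum_{j=1}^n y_jG_j+\sum_{i=1}^m\sum_{j=1}^n x_iy_jF_{i,j}$ for $\mathbf{x}\in\mathbb{R}^m,\mathbf{y}\in\mathbb{R}^n$. Let $\Gamma=\frac12(F_{i,j})_{i,j}$ be the $mp\times np$ block matrix with $(i,j)$-block $\frac12 F_{i,j}$, $\Omega_1=(H_1\ \cdots\ H_m)$, $\Omega_2=(G_1\ \cdots\ G_n)$, and $M=\begin{pmatrix}0&\Gamma\\\Gamma^{\mathsf T}&0\end{pmatrix}\in\mathcal{S}^{(m+n)p}$. Suppose $M=M_1-M_2$ with $M_1,M_2\succeq0$. Define $\mathcal{B}^+(\mathbf{x},\mathbf{y})=\begin{pmatrix}\mathbf{x}\otimes I\\\mathbf{y}\otimes I\end{pmatrix}^{\mathsf T}M_1\begin{pmatrix}\mathbf{x}\otimes I\\\mathbf{y}\otimes I\end{pmatrix}+(\Omega_1\ \Omega_2)\begin{pmatrix}\mathbf{x}\otimes I\\\mathbf{y}\otimes I\end{pmatrix}+F$ and $\mathcal{B}^-(\mathbf{x},\mathbf{y})=\begin{pmatrix}\mathbf{x}\otimes I\\\mathbf{y}\otimes I\end{pmatrix}^{\mathsf T}M_2\begin{pmatrix}\mathbf{x}\otimes I\\\mathbf{y}\otimes I\end{pmatrix}$,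 where $I$ is the $p\times p$ identity. Then $\mathcal{B}=\mathcal{B}^+-\mathcal{B}^-$, and $\mathcal{B}^+$ and $\mathcal{B}^-$ are PSD-convex on $\mathbb{R}^{m+n}$.
   Context: $\mathcal{S}^p$ denotes the real symmetric $p\times p$ matrices; $A\succeq0$ means positive semidefinite and $A\preceq B$ means $B-A\succeq0$. $\mathbf{x},\mathbf{y}$ are column vectors and $\otimes$ is the Kronecker product, so $\mathbf{x}\otimes I$ is $mp\times p$. A matrix-valued function $\mathcal{G}\colon\mathbb{R}^k\to\mathcal{S}^p$ is PSD-convex on a convex set $\mathcal{C}$ if for all $\mathbf{z}_1,\mathbf{z}_2\in\mathcal{C}$ and $\mu\in(0,1)$, $\mathcal{G}(\mu\mathbf{z}_1+(1-\mu)\mathbf{z}_2)\preceq\mu\mathcal{G}(\mathbf{z}_1)+(1-\mu)\mathcal{G}(\mathbf{z}_2)$. *)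

theory Defs
  imports "HOL-Analysis.Analysis"
begin

text \<open>
  Sizes are index types: \<open>'p\<close> has \<open>p\<close> elements, \<open>'m \<times> 'p\<close> indexes the \<open>mp\<close> rows of an \<open>m\<close>-fold
  column of blocks (block index first), and a sum type indexes the concatenation of two blocks.
\<close>

definition sym_matrix :: "real^'p^'p \<Rightarrow> bool" where
  "sym_matrix A \<longleftrightarrow> transpose A = A"

definition psd :: "real^'p^'p \<Rightarrow> bool" where
  "psd A \<longleftrightarrow> sym_matrix A \<and> (\<forall>v. 0 \<le> v \<bullet> (A *v v))"

definition psd_le :: "real^'p^'p \<Rightarrow> real^'p^'p \<Rightarrow> bool" (infix "\<preceq>" 50) where
  "A \<preceq> B \<longleftrightarrow> psd (B - A)"

text \<open>The second conjunct says that \<open>\<G>\<close> takes its values in the symmetric matrices.\<close>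

definition psd_convex_on :: "(real^'k) set \<Rightarrow> (real^'k \<Rightarrow> real^'p^'p) \<Rightarrow> bool" where
  "psd_convex_on C \<G> \<longleftrightarrow>
     convex C \<and> (\<forall>z. sym_matrix (\<G> z)) \<and>
     (\<forall>z1\<in>C. \<forall>z2\<in>C. \<forall>\<mu>. 0 < \<mu> \<and> \<mu> < 1 \<longrightarrow>
        \<G> (\<mu> *\<^sub>R z1 + (1 - \<mu>) *\<^sub>R z2) \<preceq> \<mu> *\<^sub>R \<G> z1 + (1 - \<mu>) *\<^sub>R \<G> z2)"

definition hstack :: "real^'b^'a \<Rightarrow> real^'c^'a \<Rightarrow> real^('b + 'c)^'a" where
  "hstack A B = (\<chi> i k. case k of Inl j \<Rightarrow> A $ i $ j | Inr j \<Rightarrow> B $ i $ j)"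

definition vstack :: "real^'c^'a \<Rightarrow> real^'c^'b \<Rightarrow> real^'c^('a + 'b)" where
  "vstack A B = (\<chi> k j. case k of Inl i \<Rightarrow> A $ i $ j | Inr i \<Rightarrow> B $ i $ j)"

definition block_row :: "('n::finite \<Rightarrow> real^'q^'p) \<Rightarrow> real^('n \<times> 'q)^'p" where
  "block_row A = (\<chi> k jl. A (fst jl) $ k $ snd jl)"

definition block_matrix :: "('m::finite \<Rightarrow> 'n::finite \<Rightarrow> real^'q^'p) \<Rightarrow> real^('n \<times> 'q)^('m \<times> 'p)" where
  "block_matrix A = (\<chi> ik jl. A (fst ik) (fst jl) $ snd ik $ snd jl)"

text \<open>Kronecker product of a column vector with a matrix; the column index \<open>1 \<times> 'q\<close> is
  identified with \<open>'q\<close>.\<close>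

definition kron_vec :: "real^'m \<Rightarrow> real^'q^'p \<Rightarrow> real^'q^('m \<times> 'p)" where
  "kron_vec x A = (\<chi> ik l. x $ fst ik * A $ snd ik $ l)"

definition bilinear_fun ::
  "real^'p^'p \<Rightarrow> ('m \<Rightarrow> real^'p^'p) \<Rightarrow> ('n \<Rightarrow> real^'p^'p) \<Rightarrow> ('m \<Rightarrow> 'n \<Rightarrow> real^'p^'p)
    \<Rightarrow> real^'m \<Rightarrow> real^'n \<Rightarrow> real^'p^'p" where
  "bilinear_fun F H G K x y =
     F + (\<Sum>i\<in>UNIV. (x $ i) *\<^sub>R H i) + (\<Sum>j\<in>UNIV. (y $ j) *\<^sub>R G j)
       + (\<Sum>i\<in>UNIV. \<Sum>j\<in>UNIV. (x $ i * y $ j) *\<^sub>R K i j)"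

definition Gamma_matrix ::
  "('m::finite \<Rightarrow> 'n::finite \<Rightarrow> real^'p^'p) \<Rightarrow> real^('n \<times> 'p)^('m \<times> 'p)" where
  "Gamma_matrix K = (1/2) *\<^sub>R block_matrix K"

definition M_matrix ::
  "('m::finite \<Rightarrow> 'n::finite \<Rightarrow> real^'p^'p) \<Rightarrow> real^('m \<times> 'p + 'n \<times> 'p)^('m \<times> 'p + 'n \<times> 'p)" where
  "M_matrix K = vstack (hstack 0 (Gamma_matrix K)) (hstack (transpose (Gamma_matrix K)) 0)"

definition xy_kron :: "real^'m \<Rightarrow> real^'n \<Rightarrow> real^'p^('m \<times> 'p + 'n \<times> 'p)" where
  "xy_kron x y = vstack (kron_vec x (mat 1)) (kron_vec y (mat 1))"

definition B_plus ::
  "real^'p^'p \<Rightarrow> ('m \<Rightarrow> real^'p^'p) \<Rightarrow> ('n \<Rightarrow> real^'p^'p)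
    \<Rightarrow> real^('m \<times> 'p + 'n \<times> 'p)^('m \<times> 'p + 'n \<times> 'p)
    \<Rightarrow> real^'m \<Rightarrow> real^'n \<Rightarrow> real^'p^'p" where
  "B_plus F H G M1 x y =
     transpose (xy_kron x y) ** M1 ** xy_kron x y
       + hstack (block_row H) (block_row G) ** xy_kron x y + F"

definition B_minus ::
  "real^('m \<times> 'p + 'n \<times> 'p)^('m \<times> 'p + 'n \<times> 'p) \<Rightarrow> real^'m \<Rightarrow> real^'n \<Rightarrow> real^'p^'p" where
  "B_minus M2 x y = transpose (xy_kron x y) ** M2 ** xy_kron x y"

text \<open>The components \<open>x\<close> and \<open>y\<close> of \<open>z = (x, y)\<close> in \<open>(m + n)\<close>-dimensional space.\<close>

definition x_part :: "real^('m::finite + 'n::finite) \<Rightarrow> real^'m" where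
  "x_part z = (\<chi> i. z $ Inl i)"

definition y_part :: "real^('m::finite + 'n::finite) \<Rightarrow> real^'n" where
  "y_part z = (\<chi> j. z $ Inr j)"

end

theory Submission imports Defs begin

text \<open>
  Both functions are quadratic forms \<open>Z \<mapsto> Z\<^sup>T M Z\<close> with \<open>M\<close> positive semidefinite, composed with a
  linear map, plus an affine term. The convexity defect of such a function between \<open>Z\<^sub>1\<close> and \<open>Z\<^sub>2\<close>
  is exactly \<open>\<mu> (1 - \<mu>) (Z\<^sub>1 - Z\<^sub>2)\<^sup>T M (Z\<^sub>1 - Z\<^sub>2)\<close>. The decomposition holds because the
  quadratic form of the off-diagonal \<open>M\<close> is \<open>\<Sum> x\<^sub>i y\<^sub>j (F\<^sub>i\<^sub>j + F\<^sub>i\<^sub>j\<^sup>T) / 2\<close>.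
\<close>

lemma transpose_add: "transpose (A + B) = transpose A + transpose B"
  by (simp add: transpose_def vec_eq_iff)

lemma matrix_add_rdistrib:
  fixes A B :: "'a::semiring_1^'n^'m"
  shows "(A + B) ** C = A ** C + B ** C"
  by (simp add: matrix_matrix_mult_def vec_eq_iff sum.distrib distrib_right)

lemma sym_matrix_add: "sym_matrix A \<Longrightarrow> sym_matrix B \<Longrightarrow> sym_matrix (A + B)"
  by (simp add: sym_matrix_def transpose_add)

lemma sym_matrix_scaleR: "sym_matrix A \<Longrightarrow> sym_matrix (c *\<^sub>R A)"
  by (simp add: sym_matrix_def transpose_scalar)

lemma sym_matrix_sum: "(\<And>i. i \<in> S \<Longrightarrow> sym_matrix (f i)) \<Longrightarrow> sym_matrix (\<Sum>i\<in>S. f i)"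
  by (induction S rule: infinite_finite_induct)
    (auto intro: sym_matrix_add simp: sym_matrix_def transpose_def vec_eq_iff)

lemma psd_scaleR: "0 \<le> c \<Longrightarrow> psd A \<Longrightarrow> psd (c *\<^sub>R A)"
  by (simp add: psd_def sym_matrix_scaleR scaleR_matrix_vector_assoc[symmetric])

lemma sym_matrix_congruence: "sym_matrix M \<Longrightarrow> sym_matrix (transpose Z ** M ** Z)"
  by (simp add: sym_matrix_def matrix_transpose_mul matrix_mul_assoc)

lemma psd_congruence:
  assumes "psd M"
  shows "psd (transpose Z ** M ** Z)"
proof -
  have "v \<bullet> ((transpose Z ** M ** Z) *v v) = (Z *v v) \<bullet> (M *v (Z *v v))" for v
    by (simp add: matrix_vector_mul_assoc[symmetric] inner_commute[of v] dot_lmul_matrix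
        inner_commute[of "Z *v v"])
  then show ?thesis
    using assms by (simp add: psd_def sym_matrix_congruence)
qed

text \<open>The form \<open>b Z W\<close> below is bilinear, so both sides expand into the four
  products of \<open>Z1\<close> and \<open>Z2\<close>. The pure products get the coefficients \<mu>
  - \<mu>^2 and (1 - \<mu>) - (1 - \<mu>)^2, both equal to \<mu> (1 - \<mu>); the mixed ones get
  -\<mu> (1 - \<mu>).\<close>

lemma congruence_convexity_defect:
  fixes Z1 Z2 :: "real^'p^'k"
  shows "\<mu> *\<^sub>R (transpose Z1 ** M ** Z1) + (1 - \<mu>) *\<^sub>R (transpose Z2 ** M ** Z2)
      - transpose (\<mu> *\<^sub>R Z1 + (1 - \<mu>) *\<^sub>R Z2) ** M ** (\<mu> *\<^sub>R Z1 + (1 - \<mu>) *\<^sub>R Z2)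
    = (\<mu> * (1 - \<mu>)) *\<^sub>R (transpose (Z1 - Z2) ** M ** (Z1 - Z2))"
proof -
  define b where "b Z W = transpose Z ** M ** W" for Z W :: "real^'p^'k"
  have add_left: "b (Z + Z') W = b Z W + b Z' W" for Z Z' W
    by (simp add: b_def transpose_add matrix_add_rdistrib)
  have add_right: "b Z (W + W') = b Z W + b Z W'" for Z W W'
    by (simp add: b_def matrix_add_ldistrib)
  have scale_left: "b (c *\<^sub>R Z) W = c *\<^sub>R b Z W" for c Z W
    by (simp add: b_def transpose_scalar scalar_matrix_assoc[symmetric])
  have scale_right: "b Z (c *\<^sub>R W) = c *\<^sub>R b Z W" for c Z W
    by (simp add: b_def matrix_scalar_ac scalar_matrix_assoc)
  \<comment> \<open>Subtraction becomes addition of a multiple, so that the four rules for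
    \<open>b\<close> also expand the right-hand side.\<close>
  have diff: "Z - W = Z + (-1) *\<^sub>R W" for Z W :: "real^'p^'k"
    by simp
  have "\<mu> *\<^sub>R b Z1 Z1 + (1 - \<mu>) *\<^sub>R b Z2 Z2
      - b (\<mu> *\<^sub>R Z1 + (1 - \<mu>) *\<^sub>R Z2) (\<mu> *\<^sub>R Z1 + (1 - \<mu>) *\<^sub>R Z2)
    = (\<mu> * (1 - \<mu>)) *\<^sub>R b (Z1 - Z2) (Z1 - Z2)"
    unfolding diff[of Z1 Z2] add_left add_right scale_left scale_right
    by (simp add: vec_eq_iff algebra_simps)
  then show ?thesis
    by (simp add: b_def)
qed

text \<open>This is the common shape of both functions. The linear term and the constant cancel from
  the convexity defect, since the weights sum to 1, and only the quadratic form contributes.\<close>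

lemma psd_convex_on_congruence_affine:
  fixes L :: "real^'k \<Rightarrow> real^'p^'q" and A :: "real^'k \<Rightarrow> real^'p^'p"
  assumes "linear L" "linear A" "psd M" "\<And>z. sym_matrix (A z)" "sym_matrix C"
  shows "psd_convex_on UNIV (\<lambda>z. transpose (L z) ** M ** L z + A z + C)"
proof -
  have "\<mu> *\<^sub>R (transpose (L z1) ** M ** L z1 + A z1 + C)
      + (1 - \<mu>) *\<^sub>R (transpose (L z2) ** M ** L z2 + A z2 + C)
      - (transpose (L (\<mu> *\<^sub>R z1 + (1 - \<mu>) *\<^sub>R z2)) ** M ** L (\<mu> *\<^sub>R z1 + (1 - \<mu>) *\<^sub>R z2)
        + A (\<mu> *\<^sub>R z1 + (1 - \<mu>) *\<^sub>R z2) + C)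
    = (\<mu> * (1 - \<mu>)) *\<^sub>R (transpose (L z1 - L z2) ** M ** (L z1 - L z2))" for \<mu> z1 z2
    unfolding congruence_convexity_defect[symmetric] linear_add[OF assms(1)]
      linear_add[OF assms(2)] linear_scale[OF assms(1)] linear_scale[OF assms(2)]
    by (simp add: algebra_simps)
  then show ?thesis
    using assms
    by (auto simp: psd_convex_on_def psd_le_def psd_def[of M]
        intro!: sym_matrix_add sym_matrix_congruence psd_scaleR psd_congruence)
qed

lemma sum_UNIV_block:
  fixes f :: "('m::finite \<times> 'p::finite + 'n::finite \<times> 'p) \<Rightarrow> 'a::comm_monoid_add"
  shows "(\<Sum>k\<in>UNIV. f k) = (\<Sum>i\<in>UNIV. \<Sum>l\<in>UNIV. f (Inl (i, l))) + (\<Sum>j\<in>UNIV. \<Sum>l\<in>UNIV. f (Inr (j, l)))"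
  by (simp add: UNIV_Plus_UNIV[symmetric] sum.Plus sum.cartesian_product
      UNIV_Times_UNIV[symmetric] del: UNIV_Plus_UNIV UNIV_Times_UNIV)

lemma xy_kron_nth:
  "xy_kron x y $ Inl (i, k) $ l = (if k = l then x $ i else 0)"
  "xy_kron x y $ Inr (j, k) $ l = (if k = l then y $ j else 0)"
  by (simp_all add: xy_kron_def vstack_def kron_vec_def mat_def)

text \<open>The blocks of \<open>xy_kron x y\<close> are multiples of the identity, so within each
  block only the inner index equal to \<open>b\<close> survives in the sum.\<close>

lemma matrix_mult_xy_kron_nth:
  "(A ** xy_kron x y) $ a $ b
    = (\<Sum>i\<in>UNIV. x $ i * A $ a $ Inl (i, b)) + (\<Sum>j\<in>UNIV. y $ j * A $ a $ Inr (j, b))"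
  by (simp add: matrix_matrix_mult_def sum_UNIV_block xy_kron_nth if_distrib mult.commute
      cong: if_cong)

lemma transpose_xy_kron_mult_nth:
  "(transpose (xy_kron x y) ** A) $ a $ b
    = (\<Sum>i\<in>UNIV. x $ i * A $ Inl (i, a) $ b) + (\<Sum>j\<in>UNIV. y $ j * A $ Inr (j, a) $ b)"
  by (simp add: matrix_matrix_mult_def transpose_def sum_UNIV_block xy_kron_nth if_distrib
      if_distribR cong: if_cong)

lemma block_row_mult_xy_kron:
  "hstack (block_row H) (block_row G) ** xy_kron x y
    = (\<Sum>i\<in>UNIV. x $ i *\<^sub>R H i) + (\<Sum>j\<in>UNIV. y $ j *\<^sub>R G j)"
  by (simp add: vec_eq_iff matrix_mult_xy_kron_nth hstack_def block_row_def)

lemma M_matrix_nth: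
  "M_matrix K $ Inl (i, k) $ Inl (i', l) = 0"
  "M_matrix K $ Inl (i, k) $ Inr (j, l) = K i j $ k $ l / 2"
  "M_matrix K $ Inr (j, k) $ Inl (i, l) = K i j $ l $ k / 2"
  "M_matrix K $ Inr (j, k) $ Inr (j', l) = 0"
  by (simp_all add: M_matrix_def vstack_def hstack_def Gamma_matrix_def block_matrix_def
      transpose_def)

text \<open>The upper right block contributes halves of \<open>K i j\<close> and the lower left
  block halves of its transpose. Symmetry of \<open>K i j\<close> makes these equal, so they add up
  to the full bilinear term.\<close>

lemma M_matrix_congruence_xy_kron:
  assumes "\<And>i j. sym_matrix (K i j)"
  shows "transpose (xy_kron x y) ** M_matrix K ** xy_kron x y
    = (\<Sum>i\<in>UNIV. \<Sum>j\<in>UNIV. (x $ i * y $ j) *\<^sub>R K i j)"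
proof -
  have sym: "K i j $ b $ a = K i j $ a $ b" for i j a b
    using assms[of i j] by (simp add: sym_matrix_def transpose_def vec_eq_iff)
  have "(transpose (xy_kron x y) ** M_matrix K ** xy_kron x y) $ a $ b
      = (\<Sum>i\<in>UNIV. \<Sum>j\<in>UNIV. (x $ i * y $ j) *\<^sub>R K i j) $ a $ b" for a b
  proof -
    have "(transpose (xy_kron x y) ** M_matrix K ** xy_kron x y) $ a $ b
      = (\<Sum>i\<in>UNIV. \<Sum>j\<in>UNIV. x $ i * y $ j * K i j $ a $ b / 2)
        + (\<Sum>j\<in>UNIV. \<Sum>i\<in>UNIV. x $ i * y $ j * K i j $ a $ b / 2)"
      by (simp add: matrix_mult_xy_kron_nth transpose_xy_kron_mult_nth M_matrix_nth
          sym sum_distrib_left mult_ac)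
    \<comment> \<open>The column block is the outer summation index, so the contribution of the
      upper right block arrives with the sum over \<open>j\<close> outside.\<close>
    also have "(\<Sum>j\<in>UNIV. \<Sum>i\<in>UNIV. x $ i * y $ j * K i j $ a $ b / 2)
        = (\<Sum>i\<in>UNIV. \<Sum>j\<in>UNIV. x $ i * y $ j * K i j $ a $ b / 2)"
      by (rule sum.swap)
    finally show ?thesis
      by (simp add: sum.distrib[symmetric] mult.assoc)
  qed
  then show ?thesis
    by (simp add: vec_eq_iff)
qed

text \<open>Each entry is a coordinate of \<open>z\<close> times a fixed entry of the
  identity.\<close>

lemma linear_xy_kron_parts:
  "linear (\<lambda>z :: real^('m::finite + 'n::finite). xy_kron (x_part z) (y_part z) :: real^'p^('m \<times> 'p + 'n \<times> 'p))"
  by (rule linearI)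
    (auto simp: vec_eq_iff xy_kron_def vstack_def kron_vec_def x_part_def y_part_def algebra_simps
      split: sum.split)

theorem theorem7:
  fixes F :: "real^'p^'p"
    and H :: "'m::finite \<Rightarrow> real^'p^'p"
    and G :: "'n::finite \<Rightarrow> real^'p^'p"
    and K :: "'m \<Rightarrow> 'n \<Rightarrow> real^'p^'p"
    and M1 M2 :: "real^('m \<times> 'p + 'n \<times> 'p)^('m \<times> 'p + 'n \<times> 'p)"
  assumes "sym_matrix F"
    and "\<And>i. sym_matrix (H i)"
    and "\<And>j. sym_matrix (G j)"
    and "\<And>i j. sym_matrix (K i j)"
    and "M_matrix K = M1 - M2"
    and "psd M1" and "psd M2"
  shows "(\<forall>x y. bilinear_fun F H G K x y = B_plus F H G M1 x y - B_minus M2 x y)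
    \<and> psd_convex_on UNIV (\<lambda>z :: real^('m + 'n). B_plus F H G M1 (x_part z) (y_part z))
    \<and> psd_convex_on UNIV (\<lambda>z :: real^('m + 'n). B_minus M2 (x_part z) (y_part z))"
proof (intro conjI allI)
  fix x y
  \<comment> \<open>After this substitution the \<open>M2\<close> forms cancel, leaving the form of
    \<open>M_matrix K\<close>.\<close>
  have M1: "M1 = M2 + M_matrix K"
    using assms(5) by simp
  show "bilinear_fun F H G K x y = B_plus F H G M1 x y - B_minus M2 x y"
    by (simp add: bilinear_fun_def B_plus_def B_minus_def M1 matrix_add_ldistrib
        matrix_add_rdistrib M_matrix_congruence_xy_kron[OF assms(4)] block_row_mult_xy_kron)
next
  let ?A = "\<lambda>z :: real^('m + 'n). hstack (block_row H) (block_row G) ** xy_kron (x_part z) (y_part z)"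
  have "linear ?A"
    unfolding block_row_mult_xy_kron
    by (rule linearI)
      (simp_all add: x_part_def y_part_def scaleR_left_distrib sum.distrib scaleR_sum_right
        scaleR_right_distrib)
  \<comment> \<open>Symmetry becomes visible once the block product is rewritten as a linear
    combination of the \<open>H i\<close> and \<open>G j\<close>.\<close>
  moreover have "sym_matrix (?A z)" for z
    unfolding block_row_mult_xy_kron
    using assms(2,3) by (intro sym_matrix_add sym_matrix_sum sym_matrix_scaleR)
  ultimately show "psd_convex_on UNIV (\<lambda>z :: real^('m + 'n). B_plus F H G M1 (x_part z) (y_part z))"
    unfolding B_plus_def using assms(1,6)
    by (intro psd_convex_on_congruence_affine linear_xy_kron_parts)
next
  \<comment> \<open>\<open>B_minus\<close> has no affine part: the zero map and the zero constant
    take its place, and this fact discharges the symmetry premises of both.\<close>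
  have "sym_matrix (0 :: real^'p^'p)"
    by (simp add: sym_matrix_def transpose_def vec_eq_iff)
  then show "psd_convex_on UNIV (\<lambda>z :: real^('m + 'n). B_minus M2 (x_part z) (y_part z))"
    using psd_convex_on_congruence_affine[OF linear_xy_kron_parts linear_zero assms(7), of 0]
    by (simp add: B_minus_def)
qed

end
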